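(* Let $\langle U,\theta\rangle$ be an approximation space and let $E$ be the indexing set for the equivalence classes of $\theta$. Suppose $|\theta_u|>1$ for all $u\in U$. Then the principal rough set algebra $R_\theta$ is isomorphic, as a core regular double Stone algebra, to $C_3^E$ and to $TP_E$, where $C_3$ is the 3-element chain and $TP_E$ is the collection of ternary set partitions on $E$. Further, the three core regular double Stone algebras $R_\theta$, $C_3^E$ and $TP_E$ are complete and atomic (as lattices), and their centers are complete atomistic Boolean algebras isomorphic to $C_2^E$.
   Context: An approximation space $\langle U,\theta\rangle$ is a nonempty set $U$ with an equivalence relation $\theta$; $\theta_x$ denotes the $\theta$-class of $x$. The indexing set $E$ of the classes is a set in bijection with the set of $\theta$-classes. For $X\subseteq U$, $\overline{X}=\bigcup\{\theta_x:\theta_x\cap X\neq\emptyset\}$ and $\underline{X}=\bigcup\{\theta_x:\theta_x\subseteq X\}$; the pair $\langle\underline{X},\overline{X}\rangle$ is a rough set. $R_\theta$ is the set of all rough sets $\langle\underline{X},\overline{X}\rangle$, $X\subseteq U$. Complements $^c$ are in $U$. The principal rough set algebra (PRSA), also denoted $R_\theta$, has $0=\langle\emptyset,\emptyset\rangle$, $1=\langle U,U\rangle$, componentwise union as $\vee$, componentwise intersection as $\wedge$, $\langle\underline{X},\overline{X}\rangle^*=\langle\overline{X}^c,\overline{X}^c\rangle$ and $\langle\underline{X},\overline{X}\rangle^+=\langle\underline{X}^c,\underline{X}^c\rangle$. A double Stone algebra $\langle L,\wedge,\vee,*,+,0,1\rangle$ is a bounded distributive lattice with unary operations such that $y\le x^*\iff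 y\wedge x=0$, $y\ge x^+\iff y\vee x=1$, $x^*\vee x^{**}=1$ and $x^+\wedge x^{++}=0$. It is regular if $x\wedge x^+\le y\vee y^*$ for all $x,y$ (equivalently, $x^*=y^*$ and $x^+=y^+$ imply $x=y$). An element $x$ is dense if $x^*=0$ and dually dense if $x^+=1$. The core is the set of elements that are both dense and dually dense. A core regular double Stone algebra (CRDSA) is a regular double Stone algebra with nonempty core; the core then has a unique element $h$, treated as a constant, so a CRDSA is an algebra $\langle L,\wedge,\vee,*,+,0,1,h\rangle$, and CRDSA homomorphisms preserve all these operations and constants. The center is $C(L)=\{x\in L: x^*=x^+\}$, a Boolean algebra under $\wedge,\vee,{}^*$. $C_3=\{0<h<1\}$ is the 3-element chain with $0^*=1,\ h^*=0,\ 1^*=0$ and $0^+=1,\ h^+=1,\ 1^+=0$; $C_3^E$ carries pointwise operations. $C_2$ is the 2-element Boolean algebra. For a nonempty set $J$, $TP_J=\{(X_1,X_2):X_1,X_2\subseteq J,\ X_1\cap X_2=\emptyset\}$ with $(X_1,X_2)\vee(Y_1,Y_2)=(X_1\cup Y_1,X_2\cap Y_2)$, $(X_1,X_2)\wedge(Y_1,Y_2)=(X_1\cap Y_1,X_2\cup Y_2)$, $0=(\emptyset,J)$, $1=(J,\emptyset)$, $h=(\emptyset,\emptyset)$, $(X_1,X_2)^*=(X_2,X_2^c)$, $(X_1,X_2)^+=(X_1^c,X_1)$ (complements in $J$). In a lattice $P$ with least element $0$, an atom is an $a>0$ with no $x$ satisfying $0<x<a$. $P$ is atomic if every $b>0$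 has an atom $a\le b$, and atomistic if every element is the join of a set of atoms. Complete means every subset has a supremum and an infimum. *)

theory Defs
  imports "HOL-Algebra.Complete_Lattice" "HOL-Library.FuncSet" "HOL-Library.Equipollence"
begin

record 'a bdl = "'a partial_object" +
  wedge :: "'a \<Rightarrow> 'a \<Rightarrow> 'a" (infixl "\<curlywedge>\<index>" 70)
  vee :: "'a \<Rightarrow> 'a \<Rightarrow> 'a" (infixl "\<curlyvee>\<index>" 65)
  zero_elem :: 'a ("\<zero>\<index>")
  one_elem :: 'a ("\<one>\<index>")

text \<open>The order induced by the operations, packaged as an order structure of HOL-Algebra
  so that suprema, infima and completeness are the library notions.\<close>

definition order_of :: "('a, 'm) bdl_scheme \<Rightarrow> 'a gorder" where
  "order_of L = \<lparr>carrier = carrier L, eq = (=), le = (\<lambda>x y. x \<curlywedge>\<^bsub>L\<^esub> y = x)\<rparr>"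

locale bounded_distributive_lattice =
  fixes L :: "('a, 'm) bdl_scheme" (structure)
  assumes wedge_closed: "\<lbrakk>x \<in> carrier L; y \<in> carrier L\<rbrakk> \<Longrightarrow> x \<curlywedge> y \<in> carrier L"
    and vee_closed: "\<lbrakk>x \<in> carrier L; y \<in> carrier L\<rbrakk> \<Longrightarrow> x \<curlyvee> y \<in> carrier L"
    and zero_closed: "\<zero> \<in> carrier L"
    and one_closed: "\<one> \<in> carrier L"
    and wedge_commute: "\<lbrakk>x \<in> carrier L; y \<in> carrier L\<rbrakk> \<Longrightarrow> x \<curlywedge> y = y \<curlywedge> x"
    and vee_commute: "\<lbrakk>x \<in> carrier L; y \<in> carrier L\<rbrakk> \<Longrightarrow> x \<curlyvee> y = y \<curlyvee> x"
    and wedge_assoc: "\<lbrakk>x \<in> carrier L; y \<in> carrier L; z \<in> carrier L\<rbrakk>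
      \<Longrightarrow> (x \<curlywedge> y) \<curlywedge> z = x \<curlywedge> (y \<curlywedge> z)"
    and vee_assoc: "\<lbrakk>x \<in> carrier L; y \<in> carrier L; z \<in> carrier L\<rbrakk>
      \<Longrightarrow> (x \<curlyvee> y) \<curlyvee> z = x \<curlyvee> (y \<curlyvee> z)"
    and wedge_absorb: "\<lbrakk>x \<in> carrier L; y \<in> carrier L\<rbrakk> \<Longrightarrow> x \<curlywedge> (x \<curlyvee> y) = x"
    and vee_absorb: "\<lbrakk>x \<in> carrier L; y \<in> carrier L\<rbrakk> \<Longrightarrow> x \<curlyvee> (x \<curlywedge> y) = x"
    and wedge_vee_distrib: "\<lbrakk>x \<in> carrier L; y \<in> carrier L; z \<in> carrier L\<rbrakk>
      \<Longrightarrow> x \<curlywedge> (y \<curlyvee> z) = (x \<curlywedge> y) \<curlyvee> (x \<curlywedge> z)"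
    and wedge_zero: "x \<in> carrier L \<Longrightarrow> \<zero> \<curlywedge> x = \<zero>"
    and wedge_one: "x \<in> carrier L \<Longrightarrow> x \<curlywedge> \<one> = x"

definition atoms :: "('a, 'm) gorder_scheme \<Rightarrow> 'a set" where
  "atoms P = {a \<in> carrier P. \<bottom>\<^bsub>P\<^esub> \<sqsubset>\<^bsub>P\<^esub> a \<and> \<not> (\<exists>x \<in> carrier P. \<bottom>\<^bsub>P\<^esub> \<sqsubset>\<^bsub>P\<^esub> x \<and> x \<sqsubset>\<^bsub>P\<^esub> a)}"

definition atomic :: "('a, 'm) gorder_scheme \<Rightarrow> bool" where
  "atomic P \<longleftrightarrow> (\<forall>b \<in> carrier P. \<bottom>\<^bsub>P\<^esub> \<sqsubset>\<^bsub>P\<^esub> b \<longrightarrow> (\<exists>a \<in> atoms P. a \<sqsubseteq>\<^bsub>P\<^esub> b))"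

definition atomistic :: "('a, 'm) gorder_scheme \<Rightarrow> bool" where
  "atomistic P \<longleftrightarrow> (\<forall>b \<in> carrier P. \<exists>A \<subseteq> atoms P. is_lub P b A)"

record 'a balg = "'a bdl" +
  compl_op :: "'a \<Rightarrow> 'a"

locale boolean_alg = bounded_distributive_lattice L
  for L :: "('a, 'm) balg_scheme" (structure) +
  assumes compl_closed: "x \<in> carrier L \<Longrightarrow> compl_op L x \<in> carrier L"
    and wedge_compl: "x \<in> carrier L \<Longrightarrow> x \<curlywedge> compl_op L x = \<zero>"
    and vee_compl: "x \<in> carrier L \<Longrightarrow> x \<curlyvee> compl_op L x = \<one>"

definition balg_iso :: "'a balg \<Rightarrow> 'b balg \<Rightarrow> ('a \<Rightarrow> 'b) set" where
  "balg_iso L M = {f. bij_betw f (carrier L) (carrier M)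
     \<and> (\<forall>x \<in> carrier L. \<forall>y \<in> carrier L. f (x \<curlywedge>\<^bsub>L\<^esub> y) = f x \<curlywedge>\<^bsub>M\<^esub> f y)
     \<and> (\<forall>x \<in> carrier L. \<forall>y \<in> carrier L. f (x \<curlyvee>\<^bsub>L\<^esub> y) = f x \<curlyvee>\<^bsub>M\<^esub> f y)
     \<and> (\<forall>x \<in> carrier L. f (compl_op L x) = compl_op M (f x))
     \<and> f \<zero>\<^bsub>L\<^esub> = \<zero>\<^bsub>M\<^esub> \<and> f \<one>\<^bsub>L\<^esub> = \<one>\<^bsub>M\<^esub>}"

definition balg_isomorphic :: "'a balg \<Rightarrow> 'b balg \<Rightarrow> bool" where
  "balg_isomorphic L M \<longleftrightarrow> balg_iso L M \<noteq> {}"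

definition C2 :: "bool balg" where
  "C2 = \<lparr>carrier = UNIV, wedge = (\<and>), vee = (\<or>), zero_elem = False, one_elem = True,
         compl_op = Not\<rparr>"

definition balg_power :: "'a balg \<Rightarrow> 'i set \<Rightarrow> ('i \<Rightarrow> 'a) balg" where
  "balg_power L J =
     \<lparr>carrier = J \<rightarrow>\<^sub>E carrier L,
      wedge = (\<lambda>f g. \<lambda>i\<in>J. f i \<curlywedge>\<^bsub>L\<^esub> g i),
      vee = (\<lambda>f g. \<lambda>i\<in>J. f i \<curlyvee>\<^bsub>L\<^esub> g i),
      zero_elem = (\<lambda>i\<in>J. \<zero>\<^bsub>L\<^esub>),
      one_elem = (\<lambda>i\<in>J. \<one>\<^bsub>L\<^esub>),
      compl_op = (\<lambda>f. \<lambda>i\<in>J. compl_op L (f i))\<rparr>"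

record 'a dsa = "'a bdl" +
  star :: "'a \<Rightarrow> 'a"
  plus_op :: "'a \<Rightarrow> 'a"

locale double_stone_algebra = bounded_distributive_lattice L
  for L :: "('a, 'm) dsa_scheme" (structure) +
  assumes star_closed: "x \<in> carrier L \<Longrightarrow> star L x \<in> carrier L"
    and plus_closed: "x \<in> carrier L \<Longrightarrow> plus_op L x \<in> carrier L"
    and star_pseudocomplement: "\<lbrakk>x \<in> carrier L; y \<in> carrier L\<rbrakk>
      \<Longrightarrow> le (order_of L) y (star L x) \<longleftrightarrow> y \<curlywedge> x = \<zero>"
    and plus_dual_pseudocomplement: "\<lbrakk>x \<in> carrier L; y \<in> carrier L\<rbrakk>
      \<Longrightarrow> le (order_of L) (plus_op L x) y \<longleftrightarrow> y \<curlyvee> x = \<one>"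
    and stone: "x \<in> carrier L \<Longrightarrow> star L x \<curlyvee> star L (star L x) = \<one>"
    and dual_stone: "x \<in> carrier L \<Longrightarrow> plus_op L x \<curlywedge> plus_op L (plus_op L x) = \<zero>"

locale regular_double_stone_algebra = double_stone_algebra L
  for L :: "('a, 'm) dsa_scheme" (structure) +
  assumes regular: "\<lbrakk>x \<in> carrier L; y \<in> carrier L\<rbrakk>
    \<Longrightarrow> le (order_of L) (x \<curlywedge> plus_op L x) (y \<curlyvee> star L y)"

definition dense_elems :: "('a, 'm) dsa_scheme \<Rightarrow> 'a set" where
  "dense_elems L = {x \<in> carrier L. star L x = \<zero>\<^bsub>L\<^esub>}"

definition dually_dense_elems :: "('a, 'm) dsa_scheme \<Rightarrow> 'a set" where
  "dually_dense_elems L = {x \<in> carrier L. plus_op L x = \<one>\<^bsub>L\<^esub>}"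

definition core :: "('a, 'm) dsa_scheme \<Rightarrow> 'a set" where
  "core L = dense_elems L \<inter> dually_dense_elems L"

lemma (in regular_double_stone_algebra) core_unique:
  assumes "d \<in> core L" and "e \<in> core L"
  shows "d = e"
proof -
  have below: "x \<curlywedge> y = x" if "x \<in> core L" "y \<in> core L" for x y
  proof -
    have x: "x \<in> carrier L" "plus_op L x = \<one>" and y: "y \<in> carrier L" "star L y = \<zero>"
      using that by (auto simp: core_def dense_elems_def dually_dense_elems_def)
    have "y \<curlyvee> \<zero> = y"
      using vee_absorb[OF y(1) zero_closed] wedge_zero[OF y(1)] wedge_commute[OF y(1) zero_closed]
      by simp
    then show ?thesis
      using regular[OF x(1) y(1)] x y wedge_one[OF x(1)] by (simp add: order_of_def)
  qed
  have "d \<in> carrier L" "e \<in> carrier L"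
    using assms by (auto simp: core_def dense_elems_def)
  then show ?thesis
    using below[OF assms] below[OF assms(2,1)] wedge_commute by metis
qed

record 'a crdsa = "'a dsa" +
  core_elem :: 'a

locale core_regular_double_stone_algebra = regular_double_stone_algebra L
  for L :: "('a, 'm) crdsa_scheme" (structure) +
  assumes core_elem_in_core: "core_elem L \<in> core L"

text \<open>Adjoining the core element as a constant; by \<open>core_unique\<close> the description is proper
  whenever the core of a regular double Stone algebra is nonempty.\<close>

definition with_core_elem :: "'a dsa \<Rightarrow> 'a crdsa" where
  "with_core_elem L = dsa.extend L (crdsa.fields (THE x. x \<in> core L))"

definition crdsa_iso :: "'a crdsa \<Rightarrow> 'b crdsa \<Rightarrow> ('a \<Rightarrow> 'b) set" where
  "crdsa_iso L M = {f. bij_betw f (carrier L) (carrier M)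
     \<and> (\<forall>x \<in> carrier L. \<forall>y \<in> carrier L. f (x \<curlywedge>\<^bsub>L\<^esub> y) = f x \<curlywedge>\<^bsub>M\<^esub> f y)
     \<and> (\<forall>x \<in> carrier L. \<forall>y \<in> carrier L. f (x \<curlyvee>\<^bsub>L\<^esub> y) = f x \<curlyvee>\<^bsub>M\<^esub> f y)
     \<and> (\<forall>x \<in> carrier L. f (star L x) = star M (f x))
     \<and> (\<forall>x \<in> carrier L. f (plus_op L x) = plus_op M (f x))
     \<and> f \<zero>\<^bsub>L\<^esub> = \<zero>\<^bsub>M\<^esub> \<and> f \<one>\<^bsub>L\<^esub> = \<one>\<^bsub>M\<^esub> \<and> f (core_elem L) = core_elem M}"

definition crdsa_isomorphic :: "'a crdsa \<Rightarrow> 'b crdsa \<Rightarrow> bool" where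
  "crdsa_isomorphic L M \<longleftrightarrow> crdsa_iso L M \<noteq> {}"

definition center :: "('a, 'm) dsa_scheme \<Rightarrow> 'a balg" where
  "center L = \<lparr>carrier = {x \<in> carrier L. star L x = plus_op L x},
     wedge = wedge L, vee = vee L, zero_elem = \<zero>\<^bsub>L\<^esub>, one_elem = \<one>\<^bsub>L\<^esub>, compl_op = star L\<rparr>"

datatype three = Zero3 | Half3 | One3

fun three_le :: "three \<Rightarrow> three \<Rightarrow> bool" where
  "three_le Zero3 _ = True"
| "three_le Half3 y = (y \<noteq> Zero3)"
| "three_le One3 y = (y = One3)"

definition C3 :: "three crdsa" where
  "C3 = \<lparr>carrier = UNIV,
     wedge = (\<lambda>x y. if three_le x y then x else y),
     vee = (\<lambda>x y. if three_le x y then y else x),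
     zero_elem = Zero3, one_elem = One3,
     star = (\<lambda>x. case x of Zero3 \<Rightarrow> One3 | Half3 \<Rightarrow> Zero3 | One3 \<Rightarrow> Zero3),
     plus_op = (\<lambda>x. case x of Zero3 \<Rightarrow> One3 | Half3 \<Rightarrow> One3 | One3 \<Rightarrow> Zero3),
     core_elem = Half3\<rparr>"

definition crdsa_power :: "'a crdsa \<Rightarrow> 'i set \<Rightarrow> ('i \<Rightarrow> 'a) crdsa" where
  "crdsa_power L J =
     \<lparr>carrier = J \<rightarrow>\<^sub>E carrier L,
      wedge = (\<lambda>f g. \<lambda>i\<in>J. f i \<curlywedge>\<^bsub>L\<^esub> g i),
      vee = (\<lambda>f g. \<lambda>i\<in>J. f i \<curlyvee>\<^bsub>L\<^esub> g i),
      zero_elem = (\<lambda>i\<in>J. \<zero>\<^bsub>L\<^esub>),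
      one_elem = (\<lambda>i\<in>J. \<one>\<^bsub>L\<^esub>),
      star = (\<lambda>f. \<lambda>i\<in>J. star L (f i)),
      plus_op = (\<lambda>f. \<lambda>i\<in>J. plus_op L (f i)),
      core_elem = (\<lambda>i\<in>J. core_elem L)\<rparr>"

definition TP :: "'i set \<Rightarrow> ('i set \<times> 'i set) crdsa" where
  "TP J =
     \<lparr>carrier = {(X1, X2). X1 \<subseteq> J \<and> X2 \<subseteq> J \<and> X1 \<inter> X2 = {}},
      wedge = (\<lambda>(X1, X2) (Y1, Y2). (X1 \<inter> Y1, X2 \<union> Y2)),
      vee = (\<lambda>(X1, X2) (Y1, Y2). (X1 \<union> Y1, X2 \<inter> Y2)),
      zero_elem = ({}, J),
      one_elem = (J, {}),
      star = (\<lambda>(X1, X2). (X2, J - X2)),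
      plus_op = (\<lambda>(X1, X2). (J - X1, X1)),
      core_elem = ({}, {})\<rparr>"

locale approximation_space =
  fixes U :: "'u set" and \<theta> :: "('u \<times> 'u) set"
  assumes nonempty: "U \<noteq> {}"
    and equivalence: "equiv U \<theta>"

definition upper_approx :: "'u set \<Rightarrow> ('u \<times> 'u) set \<Rightarrow> 'u set \<Rightarrow> 'u set" where
  "upper_approx U \<theta> X = \<Union>{C \<in> U // \<theta>. C \<inter> X \<noteq> {}}"

definition lower_approx :: "'u set \<Rightarrow> ('u \<times> 'u) set \<Rightarrow> 'u set \<Rightarrow> 'u set" where
  "lower_approx U \<theta> X = \<Union>{C \<in> U // \<theta>. C \<subseteq> X}"

definition rough_sets :: "'u set \<Rightarrow> ('u \<times> 'u) set \<Rightarrow> ('u set \<times> 'u set) set" where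
  "rough_sets U \<theta> = {(lower_approx U \<theta> X, upper_approx U \<theta> X) | X. X \<subseteq> U}"

definition PRSA :: "'u set \<Rightarrow> ('u \<times> 'u) set \<Rightarrow> ('u set \<times> 'u set) dsa" where
  "PRSA U \<theta> =
     \<lparr>carrier = rough_sets U \<theta>,
      wedge = (\<lambda>(A, B) (A', B'). (A \<inter> A', B \<inter> B')),
      vee = (\<lambda>(A, B) (A', B'). (A \<union> A', B \<union> B')),
      zero_elem = ({}, {}),
      one_elem = (U, U),
      star = (\<lambda>(A, B). (U - B, U - B)),
      plus_op = (\<lambda>(A, B). (U - A, U - A))\<rparr>"

end

theory Submission
  imports Defs
begin

text \<open>All lattice-theoretic claims are checked on \<open>TP E\<close> and on \<open>C\<^sub>2\<^sup>E\<close>, which is isomorphic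
  to the center of \<open>TP E\<close>, and then transported along isomorphisms.  A ternary partition
  \<open>(X\<^sub>1, X\<^sub>2)\<close> goes to the map \<open>E \<rightarrow> C\<^sub>3\<close> with value \<open>1\<close> on \<open>X\<^sub>1\<close>, \<open>0\<close> on \<open>X\<^sub>2\<close> and \<open>h\<close> elsewhere,
  and to the rough set whose lower approximation is the union of the classes indexed by \<open>X\<^sub>1\<close> and
  whose upper approximation is the union of those indexed by \<open>E - X\<^sub>2\<close>.  That every such pair is
  a rough set uses that classes have more than one element: such a class can meet a set without
  being contained in it.\<close>

section \<open>Suprema, infima and atoms of the order induced by meet\<close>

text \<open>HOL-Algebra tests upper bounds only against the members of \<open>A\<close> in the
  carrier, hence the intersection with \<open>carrier L\<close>.\<close>

lemma is_lub_order_of: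
  "is_lub (order_of L) s A \<longleftrightarrow> s \<in> carrier L \<and> (\<forall>a \<in> A \<inter> carrier L. a \<curlywedge>\<^bsub>L\<^esub> s = a)
     \<and> (\<forall>u \<in> carrier L. (\<forall>a \<in> A \<inter> carrier L. a \<curlywedge>\<^bsub>L\<^esub> u = a) \<longrightarrow> s \<curlywedge>\<^bsub>L\<^esub> u = s)"
  by (auto simp: least_def Upper_def order_of_def)

lemma is_glb_order_of:
  "is_glb (order_of L) s A \<longleftrightarrow> s \<in> carrier L \<and> (\<forall>a \<in> A \<inter> carrier L. s \<curlywedge>\<^bsub>L\<^esub> a = s)
     \<and> (\<forall>u \<in> carrier L. (\<forall>a \<in> A \<inter> carrier L. u \<curlywedge>\<^bsub>L\<^esub> a = u) \<longrightarrow> u \<curlywedge>\<^bsub>L\<^esub> s = u)"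
  by (auto simp: greatest_def Lower_def order_of_def)

context bounded_distributive_lattice
begin

text \<open>Absorption gives \<open>x \<curlyvee> (x \<curlywedge> x) = x\<close>, and meeting
  \<open>x\<close> with the left side returns \<open>x\<close>.\<close>

lemma wedge_idem: "x \<in> carrier L \<Longrightarrow> x \<curlywedge> x = x"
  using wedge_absorb[of x "x \<curlywedge> x"] vee_absorb[of x x] wedge_closed[of x x] by simp

lemma partial_order_order_of: "partial_order (order_of L)"
proof
  show "(.=\<^bsub>order_of L\<^esub>) = (=)"
    by (simp add: order_of_def)
next
  fix x y z
  assume "x \<sqsubseteq>\<^bsub>order_of L\<^esub> y" "y \<sqsubseteq>\<^bsub>order_of L\<^esub> z"
    "x \<in> carrier (order_of L)" "y \<in> carrier (order_of L)" "z \<in> carrier (order_of L)"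
  then show "x \<sqsubseteq>\<^bsub>order_of L\<^esub> z"
    using wedge_assoc[of x y z] by (simp add: order_of_def)
next
  fix x y
  assume "x \<sqsubseteq>\<^bsub>order_of L\<^esub> y" "y \<sqsubseteq>\<^bsub>order_of L\<^esub> x"
    "x \<in> carrier (order_of L)" "y \<in> carrier (order_of L)"
  then show "x .=\<^bsub>order_of L\<^esub> y"
    using wedge_commute[of x y] by (simp add: order_of_def)
qed (auto simp: order_of_def wedge_idem)

text \<open>The library picks the bottom by choice among the least elements, so zero has to be shown
  to be the only one.\<close>

lemma bottom_order_of: "\<bottom>\<^bsub>order_of L\<^esub> = \<zero>"
proof -
  have "x = \<zero>" if "least (order_of L) x (carrier (order_of L))" for x
    using that zero_closed wedge_zero[of x] wedge_commute[of x \<zero>]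
    by (auto simp: least_def order_of_def)
  moreover have "least (order_of L) \<zero> (carrier (order_of L))"
    using zero_closed wedge_zero by (auto simp: least_def order_of_def)
  ultimately show ?thesis
    unfolding bottom_def by (metis someI_ex)
qed

text \<open>Zero lies below everything, so being strictly above it is the same as being different
  from it.\<close>

lemma atoms_order_of:
  "atoms (order_of L) = {a \<in> carrier L. a \<noteq> \<zero> \<and>
     (\<forall>x \<in> carrier L. x \<curlywedge> a = x \<longrightarrow> x = \<zero> \<or> x = a)}"
  using wedge_zero zero_closed
  by (auto simp: atoms_def bottom_order_of lless_def) (auto simp: order_of_def)

lemma atomic_order_of_iff:
  "atomic (order_of L) \<longleftrightarrow>
     (\<forall>b \<in> carrier L. b \<noteq> \<zero> \<longrightarrow> (\<exists>a \<in> atoms (order_of L). a \<curlywedge> b = a))"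
  using wedge_zero by (auto simp: atomic_def bottom_order_of lless_def) (auto simp: order_of_def)

end

section \<open>Transport of order properties along bijective homomorphisms\<close>

text \<open>Closure of the target operations is not assumed: it follows from surjectivity.\<close>

locale bdl_transport = bounded_distributive_lattice L
  for L :: "('a, 'm) bdl_scheme" (structure) +
  fixes M :: "('b, 'n) bdl_scheme" and f :: "'a \<Rightarrow> 'b"
  assumes bij: "bij_betw f (carrier L) (carrier M)"
    and f_wedge: "\<lbrakk>x \<in> carrier L; y \<in> carrier L\<rbrakk> \<Longrightarrow> f (x \<curlywedge> y) = f x \<curlywedge>\<^bsub>M\<^esub> f y"
    and f_vee: "\<lbrakk>x \<in> carrier L; y \<in> carrier L\<rbrakk> \<Longrightarrow> f (x \<curlyvee> y) = f x \<curlyvee>\<^bsub>M\<^esub> f y"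
    and f_zero: "f \<zero> = \<zero>\<^bsub>M\<^esub>"
    and f_one: "f \<one> = \<one>\<^bsub>M\<^esub>"
begin

lemma carrier_image: "carrier M = f ` carrier L"
  using bij by (simp add: bij_betw_def)

lemma f_eq_iff: "\<lbrakk>x \<in> carrier L; y \<in> carrier L\<rbrakk> \<Longrightarrow> f x = f y \<longleftrightarrow> x = y"
  using bij by (auto simp: bij_betw_def dest: inj_onD)

text \<open>Oriented so that rewriting gathers an expression over \<open>M\<close> in images of
  \<open>f\<close> into the image of one expression over \<open>L\<close>, where the axioms of
  \<open>L\<close> apply.\<close>

lemmas f_hom = f_wedge[symmetric] f_vee[symmetric] f_zero[symmetric] f_one[symmetric]

lemma f_le_iff: "\<lbrakk>x \<in> carrier L; y \<in> carrier L\<rbrakk> \<Longrightarrow> f x \<curlywedge>\<^bsub>M\<^esub> f y = f x \<longleftrightarrow> x \<curlywedge> y = x"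
  by (simp add: f_hom f_eq_iff wedge_closed)

lemma bounded_distributive_lattice_image: "bounded_distributive_lattice M"
proof
  fix x y z assume "x \<in> carrier M" "y \<in> carrier M" "z \<in> carrier M"
  then obtain a b c where abc: "a \<in> carrier L" "b \<in> carrier L" "c \<in> carrier L"
      "x = f a" "y = f b" "z = f c"
    by (auto simp: carrier_image)
  show "(x \<curlywedge>\<^bsub>M\<^esub> y) \<curlywedge>\<^bsub>M\<^esub> z = x \<curlywedge>\<^bsub>M\<^esub> (y \<curlywedge>\<^bsub>M\<^esub> z)"
    using abc by (simp add: f_hom wedge_closed wedge_assoc)
  show "(x \<curlyvee>\<^bsub>M\<^esub> y) \<curlyvee>\<^bsub>M\<^esub> z = x \<curlyvee>\<^bsub>M\<^esub> (y \<curlyvee>\<^bsub>M\<^esub> z)"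
    using abc by (simp add: f_hom vee_closed vee_assoc)
  show "x \<curlywedge>\<^bsub>M\<^esub> (y \<curlyvee>\<^bsub>M\<^esub> z) = (x \<curlywedge>\<^bsub>M\<^esub> y) \<curlyvee>\<^bsub>M\<^esub> (x \<curlywedge>\<^bsub>M\<^esub> z)"
    using abc by (simp add: f_hom wedge_closed vee_closed wedge_vee_distrib)
next
  fix x y assume "x \<in> carrier M" "y \<in> carrier M"
  then obtain a b where ab: "a \<in> carrier L" "b \<in> carrier L" "x = f a" "y = f b"
    by (auto simp: carrier_image)
  show "x \<curlywedge>\<^bsub>M\<^esub> y \<in> carrier M" "x \<curlyvee>\<^bsub>M\<^esub> y \<in> carrier M"
    using ab by (auto simp: f_hom carrier_image wedge_closed vee_closed)
  show "x \<curlywedge>\<^bsub>M\<^esub> y = y \<curlywedge>\<^bsub>M\<^esub> x"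
    using ab by (metis f_wedge wedge_commute)
  show "x \<curlyvee>\<^bsub>M\<^esub> y = y \<curlyvee>\<^bsub>M\<^esub> x"
    using ab by (metis f_vee vee_commute)
  show "x \<curlywedge>\<^bsub>M\<^esub> (x \<curlyvee>\<^bsub>M\<^esub> y) = x"
    using ab by (simp add: f_hom vee_closed wedge_absorb)
  show "x \<curlyvee>\<^bsub>M\<^esub> (x \<curlywedge>\<^bsub>M\<^esub> y) = x"
    using ab by (simp add: f_hom wedge_closed vee_absorb)
next
  fix x assume "x \<in> carrier M"
  then obtain a where a: "a \<in> carrier L" "x = f a"
    by (auto simp: carrier_image)
  show "\<zero>\<^bsub>M\<^esub> \<curlywedge>\<^bsub>M\<^esub> x = \<zero>\<^bsub>M\<^esub>" "x \<curlywedge>\<^bsub>M\<^esub> \<one>\<^bsub>M\<^esub> = x"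
    using a by (simp_all add: f_hom zero_closed one_closed wedge_zero wedge_one)
qed (auto simp: f_hom carrier_image zero_closed one_closed)

text \<open>By \<open>f_le_iff\<close> the map is an order isomorphism, and every candidate bound in
  \<open>M\<close> is an image. With \<open>A\<close> inside \<open>carrier L\<close>, no stray
  point of \<open>A\<close> can gain an image in \<open>carrier M\<close> that counts as a new
  constraint.\<close>

lemma is_lub_image:
  assumes "A \<subseteq> carrier L" "is_lub (order_of L) s A"
  shows "is_lub (order_of M) (f s) (f ` A)"
proof -
  have "A \<inter> carrier L = A" "f ` A \<inter> carrier M = f ` A"
    using assms(1) by (auto simp: carrier_image)
  then show ?thesis
    using assms by (auto simp: is_lub_order_of carrier_image f_le_iff subset_iff)
qed

lemma is_glb_image:
  assumes "A \<subseteq> carrier L" "is_glb (order_of L) s A"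
  shows "is_glb (order_of M) (f s) (f ` A)"
proof -
  have "A \<inter> carrier L = A" "f ` A \<inter> carrier M = f ` A"
    using assms(1) by (auto simp: carrier_image)
  then show ?thesis
    using assms by (auto simp: is_glb_order_of carrier_image f_le_iff subset_iff)
qed

text \<open>Every subset of \<open>carrier M\<close> is the image of a subset of
  \<open>carrier L\<close>, whose bounds are then pushed forward.\<close>

lemma complete_lattice_image:
  assumes "complete_lattice (order_of L)"
  shows "complete_lattice (order_of M)"
proof -
  interpret M: bounded_distributive_lattice M
    by (rule bounded_distributive_lattice_image)
  interpret C: complete_lattice "order_of L"
    by (rule assms)
  have carrier: "carrier (order_of L) = carrier L" "carrier (order_of M) = carrier M"
    by (simp_all add: order_of_def)
  show ?thesis
  proof (rule partial_order.complete_latticeI[OF M.partial_order_order_of])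
    fix B assume "B \<subseteq> carrier (order_of M)"
    then obtain A where A: "A \<subseteq> carrier L" "B = f ` A"
      unfolding carrier by (metis carrier_image subset_image_iff)
    show "\<exists>s. is_lub (order_of M) s B"
      using A C.sup_exists[of A] is_lub_image[OF A(1)] by (auto simp: carrier)
    show "\<exists>i. is_glb (order_of M) i B"
      using A C.inf_exists[of A] is_glb_image[OF A(1)] by (auto simp: carrier)
  qed
qed

lemma atoms_image: "atoms (order_of M) = f ` atoms (order_of L)"
proof -
  interpret M: bounded_distributive_lattice M
    by (rule bounded_distributive_lattice_image)
  show ?thesis
    by (auto simp: M.atoms_order_of atoms_order_of carrier_image f_hom(3) f_le_iff f_eq_iff
        zero_closed)
qed

lemma atomic_image:
  assumes "atomic (order_of L)"
  shows "atomic (order_of M)"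
proof -
  interpret M: bounded_distributive_lattice M
    by (rule bounded_distributive_lattice_image)
  have "a \<in> carrier L" if "a \<in> atoms (order_of L)" for a
    using that by (simp add: atoms_order_of)
  with assms show ?thesis
    unfolding M.atomic_order_of_iff atomic_order_of_iff
    by (auto simp: atoms_image carrier_image f_hom(3) f_le_iff f_eq_iff zero_closed)
qed

lemma atomistic_image:
  assumes "atomistic (order_of L)"
  shows "atomistic (order_of M)"
  unfolding atomistic_def
proof
  fix y assume "y \<in> carrier (order_of M)"
  then obtain x where x: "x \<in> carrier L" "y = f x"
    by (auto simp: order_of_def carrier_image)
  with assms obtain A where A: "A \<subseteq> atoms (order_of L)" "is_lub (order_of L) x A"
    by (auto simp: atomistic_def order_of_def)
  have "A \<subseteq> carrier L"
    using A(1) by (auto simp: atoms_order_of)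
  from is_lub_image[OF this A(2)] A(1) x
  show "\<exists>B \<subseteq> atoms (order_of M). is_lub (order_of M) y B"
    by (metis atoms_image image_mono)
qed

end

section \<open>Isomorphisms of the algebras and of their centers\<close>

lemma bdl_transport_crdsa_iso:
  assumes "core_regular_double_stone_algebra L" and "f \<in> crdsa_iso L M"
  shows "bdl_transport L M f"
proof -
  interpret core_regular_double_stone_algebra L by (rule assms(1))
  show ?thesis
    using assms(2) by unfold_locales (auto simp: crdsa_iso_def)
qed

lemma bdl_transport_balg_iso:
  assumes "boolean_alg L" and "f \<in> balg_iso L M"
  shows "bdl_transport L M f"
proof -
  interpret boolean_alg L by (rule assms(1))
  show ?thesis
    using assms(2) by unfold_locales (auto simp: balg_iso_def)
qed

text \<open>Each axiom for \<open>M\<close> speaks of images under \<open>f\<close>; the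
  homomorphism equations and injectivity reduce it to the same axiom for \<open>L\<close>.\<close>

lemma core_regular_double_stone_algebra_iso:
  assumes "core_regular_double_stone_algebra L" and f: "f \<in> crdsa_iso L M"
  shows "core_regular_double_stone_algebra M"
proof -
  interpret core_regular_double_stone_algebra L by (rule assms(1))
  interpret T: bdl_transport L M f by (rule bdl_transport_crdsa_iso[OF assms])
  interpret M: bounded_distributive_lattice M by (rule T.bounded_distributive_lattice_image)
  have hom: "star M (f x) = f (star L x)" "plus_op M (f x) = f (plus_op L x)"
    if "x \<in> carrier L" for x
    using f that by (auto simp: crdsa_iso_def)
  have core: "core_elem M = f (core_elem L)"
    using f by (simp add: crdsa_iso_def)
  note T = T.f_hom T.f_eq_iff hom wedge_closed vee_closed zero_closed one_closed
    star_closed plus_closed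
  have le: "le (order_of M) (f x) (f y) \<longleftrightarrow> le (order_of L) x y"
    if "x \<in> carrier L" "y \<in> carrier L" for x y
    using that by (simp add: order_of_def T.f_le_iff)
  show ?thesis
  proof
    fix x y assume "x \<in> carrier M" "y \<in> carrier M"
    then obtain a b where ab: "a \<in> carrier L" "b \<in> carrier L" "x = f a" "y = f b"
      by (auto simp: T.carrier_image)
    show "le (order_of M) y (star M x) \<longleftrightarrow> y \<curlywedge>\<^bsub>M\<^esub> x = \<zero>\<^bsub>M\<^esub>"
      using ab star_pseudocomplement[of a b] by (simp add: T le)
    show "le (order_of M) (plus_op M x) y \<longleftrightarrow> y \<curlyvee>\<^bsub>M\<^esub> x = \<one>\<^bsub>M\<^esub>"
      using ab plus_dual_pseudocomplement[of a b] by (simp add: T le)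
    show "le (order_of M) (x \<curlywedge>\<^bsub>M\<^esub> plus_op M x) (y \<curlyvee>\<^bsub>M\<^esub> star M y)"
      using ab regular[of a b] by (simp add: T le)
  next
    fix x assume "x \<in> carrier M"
    then obtain a where a: "a \<in> carrier L" "x = f a"
      by (auto simp: T.carrier_image)
    show "star M x \<in> carrier M" "plus_op M x \<in> carrier M"
      using a by (auto simp: T T.carrier_image)
    show "star M x \<curlyvee>\<^bsub>M\<^esub> star M (star M x) = \<one>\<^bsub>M\<^esub>"
      using a by (simp add: T stone)
    show "plus_op M x \<curlywedge>\<^bsub>M\<^esub> plus_op M (plus_op M x) = \<zero>\<^bsub>M\<^esub>"
      using a by (simp add: T dual_stone)
  next
    show "core_elem M \<in> core M"
      using core_elem_in_core
      by (auto simp: core_def dense_elems_def dually_dense_elems_def core T T.carrier_image)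
  qed
qed

lemma boolean_alg_iso:
  assumes "boolean_alg L" and f: "f \<in> balg_iso L M"
  shows "boolean_alg M"
proof -
  interpret boolean_alg L by (rule assms(1))
  interpret T: bdl_transport L M f by (rule bdl_transport_balg_iso[OF assms])
  interpret M: bounded_distributive_lattice M by (rule T.bounded_distributive_lattice_image)
  have hom: "compl_op M (f x) = f (compl_op L x)" if "x \<in> carrier L" for x
    using f that by (auto simp: balg_iso_def)
  show ?thesis
    by unfold_locales
      (auto simp: T.carrier_image hom T.f_hom compl_closed wedge_compl vee_compl)
qed

lemma balg_iso_trans:
  assumes "f \<in> balg_iso K L" and "g \<in> balg_iso L M"
  shows "g \<circ> f \<in> balg_iso K M"
proof -
  have "f x \<in> carrier L" if "x \<in> carrier K" for x
    using assms(1) that by (auto simp: balg_iso_def bij_betw_def)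
  with assms show ?thesis
    by (auto simp: balg_iso_def intro: bij_betw_trans)
qed

lemma crdsa_iso_trans:
  assumes "f \<in> crdsa_iso K L" and "g \<in> crdsa_iso L M"
  shows "g \<circ> f \<in> crdsa_iso K M"
proof -
  have "f x \<in> carrier L" if "x \<in> carrier K" for x
    using assms(1) that by (auto simp: crdsa_iso_def bij_betw_def)
  with assms show ?thesis
    by (auto simp: crdsa_iso_def intro: bij_betw_trans)
qed

text \<open>Arguments in \<open>M\<close> are written as \<open>f x\<close>; after the operations
  are gathered under \<open>f\<close>, the inverse cancels it.\<close>

lemma balg_iso_sym:
  assumes "boolean_alg L" and f: "f \<in> balg_iso L M"
  shows "inv_into (carrier L) f \<in> balg_iso M L"
proof -
  interpret boolean_alg L by (rule assms(1))
  interpret T: bdl_transport L M f by (rule bdl_transport_balg_iso[OF assms])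
  have inv: "inv_into (carrier L) f (f x) = x" if "x \<in> carrier L" for x
    using T.bij that by (simp add: bij_betw_def)
  have hom: "compl_op M (f x) = f (compl_op L x)" if "x \<in> carrier L" for x
    using f that by (auto simp: balg_iso_def)
  show ?thesis
    using bij_betw_inv_into[OF T.bij] unfolding balg_iso_def T.carrier_image
    by (auto simp: hom T.f_hom inv wedge_closed vee_closed compl_closed zero_closed one_closed)
qed

lemma crdsa_iso_sym:
  assumes "core_regular_double_stone_algebra L" and f: "f \<in> crdsa_iso L M"
  shows "inv_into (carrier L) f \<in> crdsa_iso M L"
proof -
  interpret core_regular_double_stone_algebra L by (rule assms(1))
  interpret T: bdl_transport L M f by (rule bdl_transport_crdsa_iso[OF assms])
  have inv: "inv_into (carrier L) f (f x) = x" if "x \<in> carrier L" for x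
    using T.bij that by (simp add: bij_betw_def)
  have hom: "star M (f x) = f (star L x)" "plus_op M (f x) = f (plus_op L x)"
    if "x \<in> carrier L" for x
    using f that by (auto simp: crdsa_iso_def)
  have core: "core_elem M = f (core_elem L)" "core_elem L \<in> carrier L"
    using f core_elem_in_core by (auto simp: crdsa_iso_def core_def dense_elems_def)
  show ?thesis
    using bij_betw_inv_into[OF T.bij] unfolding crdsa_iso_def T.carrier_image
    by (auto simp: hom core T.f_hom inv wedge_closed vee_closed star_closed plus_closed
        zero_closed one_closed)
qed

text \<open>The center is cut out by the equation \<open>star L x = plus_op L x\<close>, which an
  injective homomorphism both preserves and reflects.\<close>

lemma crdsa_iso_center:
  assumes "core_regular_double_stone_algebra L" and f: "f \<in> crdsa_iso L M"
  shows "f \<in> balg_iso (center L) (center M)"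
proof -
  interpret core_regular_double_stone_algebra L by (rule assms(1))
  interpret T: bdl_transport L M f by (rule bdl_transport_crdsa_iso[OF assms])
  have hom: "star M (f x) = f (star L x)" "plus_op M (f x) = f (plus_op L x)"
    if "x \<in> carrier L" for x
    using f that by (auto simp: crdsa_iso_def)
  have "carrier (center M) = f ` carrier (center L)"
    by (auto simp: center_def T.carrier_image hom T.f_eq_iff star_closed plus_closed)
  moreover have "inj_on f (carrier (center L))"
    using T.bij by (auto simp: bij_betw_def center_def intro: inj_on_subset)
  ultimately have "bij_betw f (carrier (center L)) (carrier (center M))"
    by (simp add: bij_betw_def)
  with f show ?thesis
    by (auto simp: balg_iso_def crdsa_iso_def center_def)
qed

section \<open>Ternary set partitions: axioms, completeness, atomicity\<close>

lemma core_regular_double_stone_algebra_TP: "core_regular_double_stone_algebra (TP J)"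
  by unfold_locales
    (auto simp: TP_def order_of_def core_def dense_elems_def dually_dense_elems_def)

lemma TP_le_iff: "X \<curlywedge>\<^bsub>TP J\<^esub> Y = X \<longleftrightarrow> fst X \<subseteq> fst Y \<and> snd Y \<subseteq> snd X"
  by (cases X, cases Y) (auto simp: TP_def)

lemma carrier_TP: "X \<in> carrier (TP J) \<longleftrightarrow> fst X \<subseteq> J \<and> snd X \<subseteq> J \<and> fst X \<inter> snd X = {}"
  by (cases X) (auto simp: TP_def)

lemma complete_lattice_TP: "complete_lattice (order_of (TP J))"
proof -
  interpret core_regular_double_stone_algebra "TP J"
    by (rule core_regular_double_stone_algebra_TP)
  show ?thesis
  proof (rule partial_order.complete_latticeI[OF partial_order_order_of])
    fix A assume "A \<subseteq> carrier (order_of (TP J))"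
    then have A: "A \<subseteq> carrier (TP J)"
      by (simp add: order_of_def)
    have bounds: "fst a \<subseteq> J" "snd a \<subseteq> J" "x \<in> fst a \<Longrightarrow> x \<notin> snd a" if "a \<in> A" for a x
      using subsetD[OF A that] by (auto simp: carrier_TP)
    \<comment> \<open>The order is inclusion in the first component and reverse inclusion in the
      second. Intersecting with \<open>J\<close> handles the empty family, whose intersection is the
      whole type; its supremum becomes the zero \<open>({}, J)\<close>.\<close>
    have "is_lub (order_of (TP J)) (\<Union>(fst ` A), J \<inter> \<Inter>(snd ` A)) A"
      unfolding is_lub_order_of TP_le_iff fst_conv snd_conv
    proof (intro conjI ballI impI)
      show "(\<Union>(fst ` A), J \<inter> \<Inter>(snd ` A)) \<in> carrier (TP J)"
        using bounds by (auto simp: carrier_TP)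
    next
      fix a assume "a \<in> A \<inter> carrier (TP J)"
      then show "fst a \<subseteq> \<Union>(fst ` A)" "J \<inter> \<Inter>(snd ` A) \<subseteq> snd a"
        by blast+
    next
      fix u assume "\<forall>a \<in> A \<inter> carrier (TP J). fst a \<subseteq> fst u \<and> snd u \<subseteq> snd a"
        "u \<in> carrier (TP J)"
      with A carrier_TP[of u J] show "\<Union>(fst ` A) \<subseteq> fst u" "snd u \<subseteq> J \<inter> \<Inter>(snd ` A)"
        by blast+
    qed
    then show "\<exists>s. is_lub (order_of (TP J)) s A" ..
    \<comment> \<open>Dually, the empty family gets the infimum \<open>(J, {})\<close>, the one of
      \<open>TP J\<close>.\<close>
    have "is_glb (order_of (TP J)) (J \<inter> \<Inter>(fst ` A), \<Union>(snd ` A)) A"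
      unfolding is_glb_order_of TP_le_iff fst_conv snd_conv
    proof (intro conjI ballI impI)
      have "J \<inter> \<Inter>(fst ` A) \<inter> \<Union>(snd ` A) = {}"
        using bounds(3) by blast
      with bounds(2) show "(J \<inter> \<Inter>(fst ` A), \<Union>(snd ` A)) \<in> carrier (TP J)"
        by (simp add: carrier_TP UN_subset_iff)
    next
      fix a assume "a \<in> A \<inter> carrier (TP J)"
      then show "J \<inter> \<Inter>(fst ` A) \<subseteq> fst a" "snd a \<subseteq> \<Union>(snd ` A)"
        by blast+
    next
      fix u assume "\<forall>a \<in> A \<inter> carrier (TP J). fst u \<subseteq> fst a \<and> snd a \<subseteq> snd u"
        "u \<in> carrier (TP J)"
      with A carrier_TP[of u J] show "fst u \<subseteq> J \<inter> \<Inter>(fst ` A)" "\<Union>(snd ` A) \<subseteq> snd u"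
        by blast+
    qed
    then show "\<exists>i. is_glb (order_of (TP J)) i A" ..
  qed
qed

text \<open>Moving a single point \<open>j\<close> of the zero \<open>({}, J)\<close> out of the
  second component gives an atom; as a map to the 3-chain it is h at \<open>j\<close> and 0
  elsewhere.\<close>

lemma atomic_TP: "atomic (order_of (TP J))"
proof -
  interpret core_regular_double_stone_algebra "TP J"
    by (rule core_regular_double_stone_algebra_TP)
  have atom: "({}, J - {j}) \<in> atoms (order_of (TP J))" if "j \<in> J" for j
    using that unfolding atoms_order_of by (auto simp: TP_def)
  show ?thesis
    unfolding atomic_order_of_iff
  proof (intro ballI impI)
    fix b assume b: "b \<in> carrier (TP J)" "b \<noteq> \<zero>\<^bsub>TP J\<^esub>"
    \<comment> \<open>If the second component were all of \<open>J\<close>, disjointness would empty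
      the first and \<open>b\<close> would be zero.\<close>
    then obtain j where "j \<in> J" "j \<notin> snd b"
      by (fastforce simp: TP_def)
    then show "\<exists>a \<in> atoms (order_of (TP J)). a \<curlywedge>\<^bsub>TP J\<^esub> b = a"
      using b by (intro bexI[OF _ atom]) (auto simp: TP_def)
  qed
qed

section \<open>Powers of the 2-element Boolean algebra and the center of \<open>TP J\<close>\<close>

lemma boolean_alg_C2_power: "boolean_alg (balg_power C2 J)"
  by unfold_locales (auto simp: balg_power_def C2_def fun_eq_iff PiE_def extensional_def)

text \<open>Outside \<open>J\<close> both \<open>f\<close> and the restricted meet are undefined, so
  their equality is decided on \<open>J\<close>, where it is implication.\<close>

lemma C2_power_le_iff:
  "f \<in> carrier (balg_power C2 J) \<Longrightarrow>
     f \<curlywedge>\<^bsub>balg_power C2 J\<^esub> g = f \<longleftrightarrow> (\<forall>j\<in>J. f j \<longrightarrow> g j)"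
  by (auto simp: balg_power_def C2_def fun_eq_iff PiE_def extensional_def)

lemma carrier_C2_power: "f \<in> carrier (balg_power C2 J) \<longleftrightarrow> f \<in> extensional J"
  by (simp add: balg_power_def C2_def PiE_def)

lemma complete_lattice_C2_power: "complete_lattice (order_of (balg_power C2 J))"
proof -
  interpret boolean_alg "balg_power C2 J"
    by (rule boolean_alg_C2_power)
  show ?thesis
  proof (rule partial_order.complete_latticeI[OF partial_order_order_of])
    fix A assume "A \<subseteq> carrier (order_of (balg_power C2 J))"
    \<comment> \<open>Suprema and infima are the pointwise existential and universal quantifiers,
      over the same members of \<open>A\<close> that the library's bounds consider.\<close>
    have "is_lub (order_of (balg_power C2 J)) (\<lambda>j\<in>J. \<exists>a\<in>A \<inter> carrier (balg_power C2 J). a j) A"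
      unfolding is_lub_order_of by (auto simp: C2_power_le_iff carrier_C2_power)
    then show "\<exists>s. is_lub (order_of (balg_power C2 J)) s A"
      by (intro exI)
    have "is_glb (order_of (balg_power C2 J)) (\<lambda>j\<in>J. \<forall>a\<in>A \<inter> carrier (balg_power C2 J). a j) A"
      unfolding is_glb_order_of by (auto simp: C2_power_le_iff carrier_C2_power)
    then show "\<exists>i. is_glb (order_of (balg_power C2 J)) i A"
      by (intro exI)
  qed
qed

text \<open>Functions into truth values are subsets of \<open>J\<close>: the indicators of
  singletons are atoms, and \<open>b\<close> is the join of those at the points where it
  holds.\<close>

lemma atomistic_C2_power: "atomistic (order_of (balg_power C2 J))"
proof -
  interpret boolean_alg "balg_power C2 J"
    by (rule boolean_alg_C2_power)
  have atom: "(\<lambda>i\<in>J. i = j) \<in> atoms (order_of (balg_power C2 J))" if "j \<in> J" for j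
  proof -
    \<comment> \<open>A function that can hold only at \<open>j\<close> is determined by its value
      there.\<close>
    have below: "x = (\<lambda>i\<in>J. False) \<or> x = (\<lambda>i\<in>J. i = j)"
      if "x \<in> extensional J" "\<forall>i\<in>J. x i \<longrightarrow> i = j" for x
    proof (cases "x j")
      case True
      with that have "x = (\<lambda>i\<in>J. i = j)"
        by (intro extensionalityI[of _ J]) auto
      then show ?thesis ..
    next
      case False
      with that have "x = (\<lambda>i\<in>J. False)"
        by (intro extensionalityI[of _ J]) auto
      then show ?thesis ..
    qed
    have zero: "\<zero>\<^bsub>balg_power C2 J\<^esub> = (\<lambda>i\<in>J. False)"
      by (simp add: balg_power_def C2_def)
    show ?thesis
      unfolding atoms_order_of zero
    proof (intro CollectI conjI ballI impI)
      show "(\<lambda>i\<in>J. i = j) \<in> carrier (balg_power C2 J)"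
        by (simp add: carrier_C2_power)
      show "(\<lambda>i\<in>J. i = j) \<noteq> (\<lambda>i\<in>J. False)"
        using \<open>j \<in> J\<close> by (auto dest: fun_cong[of _ _ j])
      fix x
      assume x: "x \<in> carrier (balg_power C2 J)"
        and le: "x \<curlywedge>\<^bsub>balg_power C2 J\<^esub> (\<lambda>i\<in>J. i = j) = x"
      have "x \<in> extensional J" "\<forall>i\<in>J. x i \<longrightarrow> i = j"
        using x le[unfolded C2_power_le_iff[OF x]] by (simp_all add: carrier_C2_power)
      then show "x = (\<lambda>i\<in>J. False) \<or> x = (\<lambda>i\<in>J. i = j)"
        by (rule below)
    qed
  qed
  show ?thesis
    unfolding atomistic_def
  proof
    fix b assume "b \<in> carrier (order_of (balg_power C2 J))"
    then have b: "b \<in> carrier (balg_power C2 J)"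
      by (simp add: order_of_def)
    let ?A = "(\<lambda>j. \<lambda>i\<in>J. i = j) ` {j \<in> J. b j}"
    have "is_lub (order_of (balg_power C2 J)) b ?A"
      unfolding is_lub_order_of
    proof (intro conjI ballI impI)
      fix u
      assume u: "u \<in> carrier (balg_power C2 J)"
        "\<forall>a\<in>?A \<inter> carrier (balg_power C2 J). a \<curlywedge>\<^bsub>balg_power C2 J\<^esub> u = a"
      \<comment> \<open>The upper bound \<open>u\<close> dominates the indicator of
        \<open>j\<close>; evaluating this comparison at \<open>j\<close> gives the claim.\<close>
      have "u j" if "j \<in> J" "b j" for j
      proof -
        have atom_j: "(\<lambda>i\<in>J. i = j) \<in> carrier (balg_power C2 J)"
          by (simp add: carrier_C2_power)
        have "(\<lambda>i\<in>J. i = j) \<in> ?A"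
          using that by blast
        with u(2) atom_j have "(\<lambda>i\<in>J. i = j) \<curlywedge>\<^bsub>balg_power C2 J\<^esub> u = (\<lambda>i\<in>J. i = j)"
          by blast
        then show ?thesis
          unfolding C2_power_le_iff[OF atom_j] using that by simp
      qed
      with b show "b \<curlywedge>\<^bsub>balg_power C2 J\<^esub> u = b"
        by (simp add: C2_power_le_iff)
    qed (use b in \<open>auto simp: C2_power_le_iff\<close>)
    moreover have "?A \<subseteq> atoms (order_of (balg_power C2 J))"
      using atom by auto
    ultimately show "\<exists>A \<subseteq> atoms (order_of (balg_power C2 J)).
        is_lub (order_of (balg_power C2 J)) b A"
      by blast
  qed
qed

text \<open>For a pair \<open>(X1, X2)\<close> star and plus are \<open>(X2, J - X2)\<close> and
  \<open>(J - X1, X1)\<close>; they agree exactly when \<open>X2 = J - X1\<close>, so a central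
  element is a subset of \<open>J\<close> with its complement.\<close>

lemma C2_power_iso_center_TP:
  "(\<lambda>b. ({j \<in> J. b j}, {j \<in> J. \<not> b j})) \<in> balg_iso (balg_power C2 J) (center (TP J))"
proof -
  have "bij_betw (\<lambda>b. ({j \<in> J. b j}, {j \<in> J. \<not> b j}))
      (carrier (balg_power C2 J)) (carrier (center (TP J)))"
    by (rule bij_betw_byWitness[where f' = "\<lambda>(X1, X2). \<lambda>j\<in>J. j \<in> X1"])
      (auto simp: balg_power_def C2_def center_def TP_def fun_eq_iff PiE_def extensional_def)
  then show ?thesis
    by (auto simp: balg_iso_def balg_power_def C2_def center_def TP_def)
qed

section \<open>Ternary partitions as maps to the 3-element chain\<close>

definition three_of :: "'i set \<Rightarrow> 'i set \<times> 'i set \<Rightarrow> 'i \<Rightarrow> three" where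
  "three_of J X = (\<lambda>j\<in>J. if j \<in> fst X then One3 else if j \<in> snd X then Zero3 else Half3)"

text \<open>The inverse reads off the fibers over 1 and 0. They determine the map, since any
  remaining value must be h.\<close>

lemma TP_iso_C3_power: "three_of J \<in> crdsa_iso (TP J) (crdsa_power C3 J)"
proof -
  have "bij_betw (three_of J) (carrier (TP J)) (carrier (crdsa_power C3 J))"
  proof (rule bij_betw_byWitness[where f' = "\<lambda>g. ({j \<in> J. g j = One3}, {j \<in> J. g j = Zero3})"])
    show "\<forall>g \<in> carrier (crdsa_power C3 J).
        three_of J ({j \<in> J. g j = One3}, {j \<in> J. g j = Zero3}) = g"
      by (auto simp: three_of_def crdsa_power_def C3_def fun_eq_iff PiE_def extensional_def)
        (metis three.exhaust)
  qed (auto simp: three_of_def TP_def crdsa_power_def C3_def split: if_splits)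
  then show ?thesis
    by (auto simp: crdsa_iso_def three_of_def crdsa_power_def C3_def TP_def fun_eq_iff)
qed

section \<open>Rough sets over an indexed family of classes\<close>

lemma with_core_elem_simps [simp]:
  "carrier (with_core_elem L) = carrier L"
  "wedge (with_core_elem L) = wedge L"
  "vee (with_core_elem L) = vee L"
  "zero_elem (with_core_elem L) = zero_elem L"
  "one_elem (with_core_elem L) = one_elem L"
  "star (with_core_elem L) = star L"
  "plus_op (with_core_elem L) = plus_op L"
  "core_elem (with_core_elem L) = (THE x. x \<in> core L)"
  by (simp_all add: with_core_elem_def dsa.defs crdsa.defs)

text \<open>Isolates what the argument uses of the equivalence: a disjoint cover indexed by
  \<open>E\<close>, with two distinct points available in every block.\<close>

locale indexed_partition =
  fixes U :: "'u set" and E :: "'e set" and cls :: "'e \<Rightarrow> 'u set"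
  assumes cover: "\<Union>(cls ` E) = U"
    and disjoint: "\<lbrakk>i \<in> E; j \<in> E; u \<in> cls i; u \<in> cls j\<rbrakk> \<Longrightarrow> i = j"
    and two: "i \<in> E \<Longrightarrow> \<exists>p q. p \<in> cls i \<and> q \<in> cls i \<and> p \<noteq> q"
begin

definition rough_of :: "'e set \<times> 'e set \<Rightarrow> 'u set \<times> 'u set" where
  "rough_of X = (\<Union>(cls ` fst X), \<Union>(cls ` (E - snd X)))"

lemma cls_subset: "i \<in> E \<Longrightarrow> cls i \<subseteq> U"
  using cover by auto

lemma mem_UN_iff: "\<lbrakk>A \<subseteq> E; i \<in> E; u \<in> cls i\<rbrakk> \<Longrightarrow> u \<in> \<Union>(cls ` A) \<longleftrightarrow> i \<in> A"
  using disjoint by blast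

text \<open>Since the classes cover \<open>U\<close>, membership may be tested one class at a time.
  This turns complements and intersections in \<open>U\<close> into the same operations on index
  sets.\<close>

lemma UN_eqI:
  assumes "X \<subseteq> U" "A \<subseteq> E" "\<And>i u. \<lbrakk>i \<in> E; u \<in> cls i\<rbrakk> \<Longrightarrow> u \<in> X \<longleftrightarrow> i \<in> A"
  shows "X = \<Union>(cls ` A)"
proof (rule Set.set_eqI)
  fix u
  have "\<Union>(cls ` A) \<subseteq> U"
    using assms(2) cls_subset by blast
  show "u \<in> X \<longleftrightarrow> u \<in> \<Union>(cls ` A)"
  proof (cases "u \<in> U")
    case True
    then obtain i where "i \<in> E" "u \<in> cls i"
      using cover by blast
    then show ?thesis
      by (simp only: assms(3) mem_UN_iff[OF assms(2)])
  next
    case False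
    with assms(1) \<open>\<Union>(cls ` A) \<subseteq> U\<close> show ?thesis
      by blast
  qed
qed

lemma UN_diff: "A \<subseteq> E \<Longrightarrow> U - \<Union>(cls ` A) = \<Union>(cls ` (E - A))"
  by (rule UN_eqI) (use cls_subset in \<open>auto simp only: Diff_iff mem_UN_iff\<close>)

lemma UN_Int:
  assumes "A \<subseteq> E" "B \<subseteq> E"
  shows "\<Union>(cls ` A) \<inter> \<Union>(cls ` B) = \<Union>(cls ` (A \<inter> B))"
proof (rule UN_eqI)
  show "\<Union>(cls ` A) \<inter> \<Union>(cls ` B) \<subseteq> U"
    using assms(1) cls_subset by blast
qed (use assms in \<open>auto simp only: Int_iff mem_UN_iff\<close>)

text \<open>Classes are nonempty and disjoint, so a union of classes contains only the classes it
  was formed from; hence the index set can be recovered from the union.\<close>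

lemma UN_index:
  assumes "A \<subseteq> E"
  shows "{i \<in> E. cls i \<subseteq> \<Union>(cls ` A)} = A"
proof (intro subset_antisym subsetI)
  fix i assume i: "i \<in> {i \<in> E. cls i \<subseteq> \<Union>(cls ` A)}"
  then obtain p where "p \<in> cls i"
    using two by blast
  with i show "i \<in> A"
    using mem_UN_iff[OF assms, of i p] by blast
qed (use assms in blast)

lemma UN_eq_iff: "\<lbrakk>A \<subseteq> E; B \<subseteq> E\<rbrakk> \<Longrightarrow> \<Union>(cls ` A) = \<Union>(cls ` B) \<longleftrightarrow> A = B"
  by (metis UN_index)

text \<open>Inside the classes of \<open>M\<close>, \<open>X\<close> consists of one point per class,
  a nonempty proper part because every class has at least two points.\<close>

lemma ex_set_meeting_classes:
  assumes "K \<subseteq> E" "M \<subseteq> E" "K \<inter> M = {}"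
  obtains X where "X \<subseteq> U" "{i \<in> E. cls i \<subseteq> X} = K" "{i \<in> E. cls i \<inter> X \<noteq> {}} = K \<union> M"
proof -
  obtain p q where pq: "\<And>i. i \<in> E \<Longrightarrow> p i \<in> cls i \<and> q i \<in> cls i \<and> p i \<noteq> q i"
    using two by metis
  let ?X = "\<Union>(cls ` K) \<union> p ` M"
  \<comment> \<open>The point \<open>q i\<close> witnesses that a class outside \<open>K\<close> is
    not contained in \<open>?X\<close>: by disjointness only \<open>p i\<close> could put it there,
    and \<open>q i\<close> differs from \<open>p i\<close>.\<close>
  have q: "q i \<notin> ?X" if "i \<in> E" "i \<notin> K" for i
  proof
    assume "q i \<in> ?X"
    then consider j where "j \<in> K" "q i \<in> cls j" | j where "j \<in> M" "q i = p j"
      by auto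
    then obtain j where "j \<in> E" "q i \<in> cls j" "j \<in> K \<or> q i = p j"
      using assms(1,2) pq by cases auto
    moreover from this have "i = j"
      using disjoint pq that(1) by blast
    ultimately show False
      using pq[of i] that by auto
  qed
  have "?X \<subseteq> U"
    by (intro Un_least UN_least image_subsetI) (use assms(1,2) pq cls_subset in blast)+
  moreover have "{i \<in> E. cls i \<subseteq> ?X} = K"
  proof (intro subset_antisym subsetI)
    fix i assume "i \<in> {i \<in> E. cls i \<subseteq> ?X}"
    then show "i \<in> K"
      using q pq by blast
  qed (use assms(1) in auto)
  moreover have "{i \<in> E. cls i \<inter> ?X \<noteq> {}} = K \<union> M"
  proof (intro subset_antisym subsetI)
    fix i assume "i \<in> {i \<in> E. cls i \<inter> ?X \<noteq> {}}"
    then obtain u where "i \<in> E" "u \<in> cls i" "u \<in> ?X"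
      by auto
    then consider j where "j \<in> K" "u \<in> cls j" | j where "j \<in> M" "u = p j"
      by auto
    then show "i \<in> K \<union> M"
    proof cases
      case 1
      with assms(1) disjoint \<open>i \<in> E\<close> \<open>u \<in> cls i\<close> show ?thesis
        by blast
    next
      case 2
      then have "j \<in> E" "u \<in> cls j"
        using assms(2) pq by auto
      with disjoint \<open>i \<in> E\<close> \<open>u \<in> cls i\<close> have "i = j"
        by blast
      with 2 show ?thesis
        by simp
    qed
  next
    fix i assume "i \<in> K \<union> M"
    then have "i \<in> E"
      using assms(1,2) by blast
    moreover from this \<open>i \<in> K \<union> M\<close> have "p i \<in> cls i \<inter> ?X"
      using pq by blast
    ultimately show "i \<in> {i \<in> E. cls i \<inter> ?X \<noteq> {}}"
      by auto
  qed
  ultimately show ?thesis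
    by (rule that)
qed

lemma TP_iso_PRSA:
  assumes quotient: "U // \<theta> = cls ` E"
  shows "rough_of \<in> crdsa_iso (TP E) (with_core_elem (PRSA U \<theta>))"
proof -
  have lower: "lower_approx U \<theta> X = \<Union>(cls ` {i \<in> E. cls i \<subseteq> X})" for X
    unfolding lower_approx_def quotient by auto
  have upper: "upper_approx U \<theta> X = \<Union>(cls ` {i \<in> E. cls i \<inter> X \<noteq> {}})" for X
    unfolding upper_approx_def quotient by auto
  have image: "rough_of ` carrier (TP E) = rough_sets U \<theta>"
  proof (intro subset_antisym subsetI)
    fix r assume "r \<in> rough_of ` carrier (TP E)"
    then obtain K N where KN: "K \<subseteq> E" "N \<subseteq> E" "K \<inter> N = {}" "r = rough_of (K, N)"
      by (auto simp: TP_def)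
    \<comment> \<open>The indices in neither \<open>K\<close> nor \<open>N\<close> form the
      boundary: their classes must meet \<open>X\<close> without lying inside it.\<close>
    then obtain X where "X \<subseteq> U" "{i \<in> E. cls i \<subseteq> X} = K"
        "{i \<in> E. cls i \<inter> X \<noteq> {}} = K \<union> (E - K - N)"
      using ex_set_meeting_classes[of K "E - K - N"] by blast
    moreover have "K \<union> (E - K - N) = E - N"
      using KN by auto
    ultimately show "r \<in> rough_sets U \<theta>"
      unfolding rough_sets_def lower upper using KN(4)
      by (intro CollectI exI[of _ X]) (simp add: rough_of_def)
  next
    fix r assume "r \<in> rough_sets U \<theta>"
    then obtain X where X: "r = (lower_approx U \<theta> X, upper_approx U \<theta> X)"
      by (auto simp: rough_sets_def)
    \<comment> \<open>The indices of the classes inside \<open>X\<close> and of those missing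
      \<open>X\<close>; the two sets are disjoint because no class is empty.\<close>
    let ?X = "({i \<in> E. cls i \<subseteq> X}, {i \<in> E. cls i \<inter> X = {}})"
    have "?X \<in> carrier (TP E)"
      using two by (fastforce simp: TP_def)
    moreover have "E - {i \<in> E. cls i \<inter> X = {}} = {i \<in> E. cls i \<inter> X \<noteq> {}}"
      by auto
    then have "r = rough_of ?X"
      by (simp add: X rough_of_def lower upper)
    ultimately show "r \<in> rough_of ` carrier (TP E)"
      by blast
  qed
  have "inj_on rough_of (carrier (TP E))"
  proof (rule inj_onI)
    fix X Y assume "X \<in> carrier (TP E)" "Y \<in> carrier (TP E)" and eq: "rough_of X = rough_of Y"
    then have "fst X \<subseteq> E" "fst Y \<subseteq> E" "snd X \<subseteq> E" "snd Y \<subseteq> E"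
      by (auto simp: TP_def)
    with eq have "fst X = fst Y" "E - snd X = E - snd Y"
      by (simp_all add: rough_of_def UN_eq_iff)
    with \<open>snd X \<subseteq> E\<close> \<open>snd Y \<subseteq> E\<close> show "X = Y"
      by (metis double_diff prod.expand subset_refl)
  qed
  with image have bij: "bij_betw rough_of (carrier (TP E)) (carrier (with_core_elem (PRSA U \<theta>)))"
    by (simp add: bij_betw_def PRSA_def)
  have sub: "A \<subseteq> U" "B \<subseteq> U" if "(A, B) \<in> rough_sets U \<theta>" for A B
    using that cls_subset by (auto simp: rough_sets_def lower upper)
  have "rough_of ({}, {}) \<in> rough_sets U \<theta>"
    unfolding image[symmetric] by (auto simp: TP_def)
  \<comment> \<open>Density forces the upper approximation to be \<open>U\<close>, and dual density
    forces the lower one to be empty. This pair is a rough set, as the image of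
    \<open>({}, {})\<close>, so the description of the core element is proper.\<close>
  then have "core (PRSA U \<theta>) = {({}, U)}"
    using sub
    by (auto simp: core_def dense_elems_def dually_dense_elems_def PRSA_def rough_of_def cover)
      blast+
  then have core: "(THE x. x \<in> core (PRSA U \<theta>)) = rough_of ({}, {})"
    by (simp add: rough_of_def cover)
  have wedge: "rough_of (X \<curlywedge>\<^bsub>TP E\<^esub> Y) = rough_of X \<curlywedge>\<^bsub>PRSA U \<theta>\<^esub> rough_of Y"
    if "X \<in> carrier (TP E)" "Y \<in> carrier (TP E)" for X Y
    using that by (simp add: TP_def PRSA_def rough_of_def split_beta UN_Int Diff_Un)
  have vee: "rough_of (X \<curlyvee>\<^bsub>TP E\<^esub> Y) = rough_of X \<curlyvee>\<^bsub>PRSA U \<theta>\<^esub> rough_of Y"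
    if "X \<in> carrier (TP E)" "Y \<in> carrier (TP E)" for X Y
    using that by (auto simp: TP_def PRSA_def rough_of_def)
  have star: "rough_of (star (TP E) X) = star (PRSA U \<theta>) (rough_of X)"
    if "X \<in> carrier (TP E)" for X
    using that by (auto simp: TP_def PRSA_def rough_of_def UN_diff double_diff)
  have plus: "rough_of (plus_op (TP E) X) = plus_op (PRSA U \<theta>) (rough_of X)"
    if "X \<in> carrier (TP E)" for X
    using that by (simp add: TP_def PRSA_def rough_of_def split_beta UN_diff)
  have "rough_of \<zero>\<^bsub>TP E\<^esub> = \<zero>\<^bsub>PRSA U \<theta>\<^esub>" "rough_of \<one>\<^bsub>TP E\<^esub> = \<one>\<^bsub>PRSA U \<theta>\<^esub>"
    "rough_of (core_elem (TP E)) = rough_of ({}, {})"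
    by (simp_all add: TP_def PRSA_def rough_of_def cover)
  with bij show ?thesis
    by (simp add: crdsa_iso_def wedge vee star plus core)
qed

end

section \<open>Applying the transport to the three algebras\<close>

lemma indexed_partition_classes:
  assumes "equiv U \<theta>" and bij: "bij_betw cls E (U // \<theta>)"
    and large: "\<And>u. u \<in> U \<Longrightarrow> {()} \<prec> \<theta> `` {u}"
  shows "indexed_partition U E cls"
proof
  have quotient: "cls ` E = U // \<theta>"
    using bij by (simp add: bij_betw_def)
  show "\<Union>(cls ` E) = U"
    unfolding quotient by (rule Union_quotient[OF assms(1)])
  fix i assume i: "i \<in> E"
  show "i = j" if "j \<in> E" "u \<in> cls i" "u \<in> cls j" for j u
  proof -
    have "cls i = cls j"
      using quotient_disj[OF assms(1)] i that quotient by blast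
    with i that bij show ?thesis
      by (auto simp: bij_betw_def dest: inj_onD)
  qed
  obtain u where u: "u \<in> U" "cls i = \<theta> `` {u}"
    using i quotient by (metis imageI quotientE)
  have "u \<in> cls i"
    using u equiv_class_self[OF assms(1)] by auto
  \<comment> \<open>A one-point class would be equipollent to \<open>{()}\<close>, against the
    strict cardinality bound.\<close>
  moreover have "cls i \<noteq> {u}"
    using large[OF u(1)] u(2) by (auto simp: lesspoll_def singleton_eqpoll)
  ultimately show "\<exists>p q. p \<in> cls i \<and> q \<in> cls i \<and> p \<noteq> q"
    by blast
qed

text \<open>Collects every property that an isomorphic copy of \<open>TP J\<close> inherits, so that
  each algebra needs only an isomorphism from \<open>TP J\<close>.\<close>

lemma crdsa_iso_TP:
  assumes f: "f \<in> crdsa_iso (TP J) M"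
  shows "core_regular_double_stone_algebra M"
    and "complete_lattice (order_of M)" and "atomic (order_of M)"
    and "boolean_alg (center M)" and "complete_lattice (order_of (center M))"
    and "atomistic (order_of (center M))" and "balg_isomorphic (center M) (balg_power C2 J)"
proof -
  note TP = core_regular_double_stone_algebra_TP[of J]
  show "core_regular_double_stone_algebra M"
    by (rule core_regular_double_stone_algebra_iso[OF TP f])
  interpret T: bdl_transport "TP J" M f
    by (rule bdl_transport_crdsa_iso[OF TP f])
  show "complete_lattice (order_of M)" "atomic (order_of M)"
    by (rule T.complete_lattice_image[OF complete_lattice_TP] T.atomic_image[OF atomic_TP])+
  \<comment> \<open>The restriction of \<open>f\<close> to centers, preceded by the identification
    of the \<open>C2\<close> power with the center of \<open>TP J\<close>.\<close>
  note g = balg_iso_trans[OF C2_power_iso_center_TP crdsa_iso_center[OF TP f]]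
  show "boolean_alg (center M)"
    by (rule boolean_alg_iso[OF boolean_alg_C2_power g])
  note C = bdl_transport_balg_iso[OF boolean_alg_C2_power g]
  show "complete_lattice (order_of (center M))"
    by (rule bdl_transport.complete_lattice_image[OF C complete_lattice_C2_power])
  show "atomistic (order_of (center M))"
    by (rule bdl_transport.atomistic_image[OF C atomistic_C2_power])
  show "balg_isomorphic (center M) (balg_power C2 J)"
    using balg_iso_sym[OF boolean_alg_C2_power g] by (auto simp: balg_isomorphic_def)
qed

theorem mainTheorem1:
  fixes U :: "'u set" and \<theta> :: "('u \<times> 'u) set" and E :: "'e set"
  assumes "approximation_space U \<theta>"
    and "\<exists>cls. bij_betw cls E (U // \<theta>)"
    and "\<And>u. u \<in> U \<Longrightarrow> {()} \<prec> \<theta> `` {u}"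
  defines "R \<equiv> with_core_elem (PRSA U \<theta>)"
    and "C3E \<equiv> crdsa_power C3 E"
    and "TPE \<equiv> TP E"
    and "C2E \<equiv> balg_power C2 E"
  shows "core_regular_double_stone_algebra R
    \<and> core_regular_double_stone_algebra C3E
    \<and> core_regular_double_stone_algebra TPE
    \<and> crdsa_isomorphic R C3E
    \<and> crdsa_isomorphic R TPE
    \<and> complete_lattice (order_of R) \<and> atomic (order_of R)
    \<and> complete_lattice (order_of C3E) \<and> atomic (order_of C3E)
    \<and> complete_lattice (order_of TPE) \<and> atomic (order_of TPE)
    \<and> boolean_alg (center R) \<and> complete_lattice (order_of (center R))
    \<and> atomistic (order_of (center R)) \<and> balg_isomorphic (center R) C2E
    \<and> boolean_alg (center C3E) \<and> complete_lattice (order_of (center C3E))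
    \<and> atomistic (order_of (center C3E)) \<and> balg_isomorphic (center C3E) C2E
    \<and> boolean_alg (center TPE) \<and> complete_lattice (order_of (center TPE))
    \<and> atomistic (order_of (center TPE)) \<and> balg_isomorphic (center TPE) C2E"
proof -
  obtain cls where cls: "bij_betw cls E (U // \<theta>)"
    using assms(2) by blast
  interpret indexed_partition U E cls
    using assms(1,3) cls
    by (intro indexed_partition_classes) (auto simp: approximation_space_def)
  have R: "rough_of \<in> crdsa_iso (TP E) R"
    unfolding R_def using cls by (intro TP_iso_PRSA) (simp add: bij_betw_def)
  have C3E: "three_of E \<in> crdsa_iso (TP E) C3E"
    unfolding C3E_def by (rule TP_iso_C3_power)
  \<comment> \<open>The identity lets \<open>TP E\<close> be treated exactly like the other two
    algebras.\<close>
  have TPE: "id \<in> crdsa_iso (TP E) TPE"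
    by (simp add: TPE_def crdsa_iso_def)
  \<comment> \<open>Both isomorphisms out of \<open>R\<close> pass through \<open>TP E\<close>, by
    inverting \<open>rough_of\<close>.\<close>
  note inv = crdsa_iso_sym[OF core_regular_double_stone_algebra_TP R]
  have "crdsa_isomorphic R C3E" "crdsa_isomorphic R TPE"
    using crdsa_iso_trans[OF inv C3E] crdsa_iso_trans[OF inv TPE]
    by (auto simp: crdsa_isomorphic_def)
  then show ?thesis
    using crdsa_iso_TP[OF R] crdsa_iso_TP[OF C3E] crdsa_iso_TP[OF TPE]
    by (simp add: C2E_def)
qed

end
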